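(* Let $\pi:G\to H$ be an open continuous homomorphism of a $PS\mathcal{M}$-factorizable topological group $G$ onto a topological group $H$. Then $H$ is $PS\mathcal{M}$-factorizable.
   Context: All topological spaces (in particular all topological groups) are assumed Hausdorff. A continuous map $f:X\to Y$ is perfect if it is closed, onto, and all fibers $f^{-1}(y)$ are compact; a perfect homomorphism is a continuous group homomorphism that is a perfect map. A topological group $G$ is $PS\mathcal{M}$-factorizable if for every continuous mapping $f:G\to M$ to a metrizable space $M$ there are a perfect homomorphism $\pi:G\to H$ onto a metrizable topological group $H$ and a continuous mapping $g:H\to M$ such that $f=g\circ\pi$. *)

theory Defs
  imports "HOL-Algebra.Coset" "HOL-Analysis.Analysis"
begin

text \<open>By convention all topological groups are Hausdorff.\<close>

definition topological_group :: "('a, 'm) monoid_scheme \<Rightarrow> 'a topology \<Rightarrow> bool" where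
  "topological_group G T \<longleftrightarrow>
     group G \<and> topspace T = carrier G \<and> Hausdorff_space T \<and>
     continuous_map (prod_topology T T) T (\<lambda>(x, y). x \<otimes>\<^bsub>G\<^esub> y) \<and>
     continuous_map T T (\<lambda>x. inv\<^bsub>G\<^esub> x)"

definition perfect_homomorphism ::
  "('a, 'm) monoid_scheme \<Rightarrow> 'a topology \<Rightarrow> ('b, 'n) monoid_scheme \<Rightarrow> 'b topology \<Rightarrow> ('a \<Rightarrow> 'b) \<Rightarrow> bool"
  where
  "perfect_homomorphism G T K S p \<longleftrightarrow> p \<in> hom G K \<and> perfect_map T S p"

text \<open>
  HOL does not allow a definition to quantify over types, so the metrizable spaces \<open>M\<close> and the
  metrizable groups \<open>K\<close> below live on the type \<^typ>\<open>'a set\<close>.  This is no restriction: up to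
  homeomorphism (isomorphism), the image of a map defined on \<open>G\<close> is the set of its fibers.
  The lemmas \<open>PSM_factorizableD\<close> and \<open>PSM_factorizableI\<close> below show that \<open>M\<close> and \<open>K\<close> may
  be taken over arbitrary types.
\<close>

definition PSM_factorizable :: "('a, 'm) monoid_scheme \<Rightarrow> 'a topology \<Rightarrow> bool" where
  "PSM_factorizable G T \<longleftrightarrow>
     topological_group G T \<and>
     (\<forall>(M :: 'a set topology) f. metrizable_space M \<and> continuous_map T M f \<longrightarrow>
        (\<exists>(K :: 'a set monoid) S p g.
           topological_group K S \<and> metrizable_space S \<and> perfect_homomorphism G T K S p \<and>
           continuous_map S M g \<and> (\<forall>x\<in>carrier G. f x = g (p x))))"

lemma topology_transport:
  assumes "inj_on h (topspace S)"
  obtains S' where "homeomorphic_maps S S' h (inv_into (topspace S) h)" "topspace S' = h ` topspace S"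
proof -
  define k where "k = inv_into (topspace S) h"
  define S' where "S' = pullback_topology (h ` topspace S) k S"
  have kh: "k (h x) = x" if "x \<in> topspace S" for x
    using assms that by (simp add: k_def)
  have top: "topspace S' = h ` topspace S"
    using kh by (auto simp: S'_def topspace_pullback_topology)
  have "continuous_map S' S k"
    using continuous_map_pullback[of S S "\<lambda>x. x" "h ` topspace S" k]
    by (simp add: S'_def o_def)
  moreover have "continuous_map S S (k \<circ> h)"
    by (rule continuous_map_eq[of _ _ "\<lambda>x. x"]) (auto simp: kh)
  then have "continuous_map S S' h"
    unfolding S'_def by (rule continuous_map_pullback') auto
  ultimately have "homeomorphic_maps S S' h k"
    using kh by (auto simp: homeomorphic_maps_def top)
  then show ?thesis using that top k_def by blast
qed

lemma topological_group_transport: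
  fixes K :: "('b, 'n) monoid_scheme"
  assumes K: "topological_group K S" and inj: "inj_on h (carrier K)"
  obtains K' :: "'c monoid" and S' where
    "topological_group K' S'" "h \<in> hom K K'" "homeomorphic_maps S S' h (inv_into (carrier K) h)"
proof -
  have grp: "group K" and top: "topspace S = carrier K" and "Hausdorff_space S"
    and mult: "continuous_map (prod_topology S S) S (\<lambda>(x, y). x \<otimes>\<^bsub>K\<^esub> y)"
    and invc: "continuous_map S S (\<lambda>x. inv\<^bsub>K\<^esub> x)"
    using K by (auto simp: topological_group_def)
  interpret group K by fact
  define k where "k = inv_into (carrier K) h"
  obtain S' where S': "homeomorphic_maps S S' h k" and top': "topspace S' = h ` carrier K"
    using topology_transport[of h S] inj unfolding top k_def by metis
  define K' where
    "K' = \<lparr>carrier = h ` carrier K, monoid.mult = \<lambda>x y. h (k x \<otimes>\<^bsub>K\<^esub> k y), one = h \<one>\<^bsub>K\<^esub>\<rparr>"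
  have kh: "k (h x) = x" if "x \<in> carrier K" for x
    using inj that by (simp add: k_def)
  have carr: "carrier K' = h ` carrier K"
    by (simp add: K'_def)
  have grp': "group K'"
  proof (rule groupI)
    fix x assume "x \<in> carrier K'"
    then obtain a where "a \<in> carrier K" "x = h a" by (auto simp: carr)
    then show "\<exists>y\<in>carrier K'. y \<otimes>\<^bsub>K'\<^esub> x = \<one>\<^bsub>K'\<^esub>"
      by (intro bexI[of _ "h (inv\<^bsub>K\<^esub> a)"]) (auto simp: K'_def kh)
  qed (auto simp: K'_def kh m_assoc)
  have inv': "inv\<^bsub>K'\<^esub> x = h (inv\<^bsub>K\<^esub> (k x))" if "x \<in> carrier K'" for x
    by (rule group.inv_equality[OF grp']) (use that in \<open>auto simp: K'_def kh\<close>)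
  have hc: "continuous_map S S' h" and kc: "continuous_map S' S k"
    using S' by (auto simp: homeomorphic_maps_def)
  have pair: "continuous_map (prod_topology S' S') (prod_topology S S) (\<lambda>z. (k (fst z), k (snd z)))"
    by (intro continuous_map_pairedI continuous_map_compose[OF continuous_map_fst kc, unfolded o_def]
        continuous_map_compose[OF continuous_map_snd kc, unfolded o_def])
  have "continuous_map (prod_topology S' S') S' (\<lambda>(x, y). x \<otimes>\<^bsub>K'\<^esub> y)"
    using continuous_map_compose[OF continuous_map_compose[OF pair mult] hc]
    by (simp add: o_def K'_def case_prod_unfold)
  moreover have "continuous_map S' S' (\<lambda>x. inv\<^bsub>K'\<^esub> x)"
    using continuous_map_compose[OF continuous_map_compose[OF kc invc] hc]
    by (rule continuous_map_eq) (simp add: inv' carr top')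
  moreover have "Hausdorff_space S'"
    using S' \<open>Hausdorff_space S\<close> homeomorphic_Hausdorff_space homeomorphic_space_def by blast
  ultimately have "topological_group K' S'"
    using grp' by (simp add: topological_group_def carr top')
  moreover have "h \<in> hom K K'"
    by (auto simp: hom_def K'_def kh)
  ultimately show ?thesis using that S' k_def by blast
qed

lemma PSM_factorizableD:
  fixes G :: "('a, 'n) monoid_scheme" and M :: "'m topology"
  assumes G: "PSM_factorizable G T" and M: "metrizable_space M" and f: "continuous_map T M f"
  shows "\<exists>(K :: 'a set monoid) S p g.
           topological_group K S \<and> metrizable_space S \<and> perfect_homomorphism G T K S p \<and>
           continuous_map S M g \<and> (\<forall>x\<in>carrier G. f x = g (p x))"
proof -
  have top: "topspace T = carrier G"
    using G by (auto simp: PSM_factorizable_def topological_group_def)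
  define N where "N = subtopology M (f ` carrier G)"
  have topN: "topspace N = f ` carrier G"
    using f by (auto simp: N_def top continuous_map_def Pi_iff)
  define h where "h y = {x \<in> carrier G. f x = y}" for y
  have inj: "inj_on h (topspace N)"
    by (auto simp: inj_on_def h_def topN)
  define k where "k = inv_into (topspace N) h"
  obtain N' where N': "homeomorphic_maps N N' h k"
    using topology_transport[OF inj] k_def by metis
  have hc: "continuous_map N N' h" and kc: "continuous_map N' N k"
    using N' by (auto simp: homeomorphic_maps_def)
  have "metrizable_space N"
    unfolding N_def by (rule metrizable_space_subtopology[OF M])
  then have M': "metrizable_space N'"
    using N' homeomorphic_metrizable_space homeomorphic_space_def by blast
  have "continuous_map T N f"
    using f by (auto simp: N_def continuous_map_in_subtopology top)
  then have "continuous_map T N' (h \<circ> f)"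
    using hc by (rule continuous_map_compose)
  then obtain K :: "'a set monoid" and S p g where K: "topological_group K S" "metrizable_space S"
      "perfect_homomorphism G T K S p" and g: "continuous_map S N' g"
      and fac: "\<forall>x\<in>carrier G. (h \<circ> f) x = g (p x)"
    using G M' unfolding PSM_factorizable_def by blast
  have "continuous_map S M (k \<circ> g)"
    using continuous_map_compose[OF g kc]
    by (simp add: N_def continuous_map_in_subtopology)
  moreover have "f x = (k \<circ> g) (p x)" if "x \<in> carrier G" for x
  proof -
    have "(k \<circ> g) (p x) = k (h (f x))" using fac that by auto
    also have "\<dots> = f x" using inj that by (simp add: k_def topN)
    finally show ?thesis by simp
  qed
  ultimately show ?thesis using K by blast
qed

lemma PSM_factorizableI:
  fixes G :: "('a, 'n) monoid_scheme"
  assumes G: "topological_group G T"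
    and fac: "\<And>(M :: 'a set topology) f. metrizable_space M \<Longrightarrow> continuous_map T M f \<Longrightarrow>
        \<exists>(K :: 'k monoid) S p g.
           topological_group K S \<and> metrizable_space S \<and> perfect_homomorphism G T K S p \<and>
           continuous_map S M g \<and> (\<forall>x\<in>carrier G. f x = g (p x))"
  shows "PSM_factorizable G T"
  unfolding PSM_factorizable_def
proof (intro conjI allI impI G, elim conjE)
  fix M :: "'a set topology" and f
  assume M: "metrizable_space M" and f: "continuous_map T M f"
  obtain K :: "'k monoid" and S p g where K: "topological_group K S" and S: "metrizable_space S"
      and p: "p \<in> hom G K" "perfect_map T S p"
      and g: "continuous_map S M g" and fg: "\<forall>x\<in>carrier G. f x = g (p x)"
    using fac[OF M f] unfolding perfect_homomorphism_def by blast
  have top: "topspace T = carrier G" "topspace S = carrier K"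
    using G K by (auto simp: topological_group_def)
  have onto: "p ` carrier G = carrier K"
    using p(2) by (simp add: perfect_map_def top)
  define h where "h y = {x \<in> carrier G. p x = y}" for y
  have inj: "inj_on h (carrier K)"
    by (auto simp: inj_on_def h_def onto[symmetric])
  define k where "k = inv_into (carrier K) h"
  obtain K' :: "'a set monoid" and S' where K': "topological_group K' S'" and h: "h \<in> hom K K'"
      and S': "homeomorphic_maps S S' h k"
    using topological_group_transport[OF K inj] k_def by metis
  have "metrizable_space S'"
    using S S' homeomorphic_metrizable_space homeomorphic_space_def by blast
  moreover have "perfect_homomorphism G T K' S' (h \<circ> p)"
  proof -
    have "h \<circ> p \<in> hom G K'"
      using p(1) h by (auto simp: hom_def Pi_iff)
    moreover have "homeomorphic_map S S' h"
      using S' homeomorphic_map_maps by blast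
    then have "perfect_map S S' h"
      by (simp add: homeomorphic_imp_perfect_map)
    ultimately show ?thesis
      using p(2) perfect_map_compose
      unfolding perfect_homomorphism_def by blast
  qed
  moreover have "continuous_map S' M (g \<circ> k)"
    using S' g by (auto simp: homeomorphic_maps_def intro: continuous_map_compose)
  moreover have "f x = (g \<circ> k) ((h \<circ> p) x)" if "x \<in> carrier G" for x
  proof -
    have "p x \<in> carrier K" using onto that by blast
    then have "k (h (p x)) = p x" using inj by (simp add: k_def)
    then show ?thesis using fg that by simp
  qed
  ultimately show "\<exists>(K :: 'a set monoid) S p g.
           topological_group K S \<and> metrizable_space S \<and> perfect_homomorphism G T K S p \<and>
           continuous_map S M g \<and> (\<forall>x\<in>carrier G. f x = g (p x))"
    using K' by blast
qed

end

theory Submission imports Defs begin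

text \<open>
  Given \<open>f\<close> on \<open>H\<close>, factor \<open>f \<circ> \<pi> = g \<circ> p\<close> through a perfect homomorphism \<open>p: G \<rightarrow> K\<close> onto a
  metrizable group.  As \<open>p\<close> is closed and onto, \<open>L = p(ker \<pi>)\<close> is a closed normal subgroup of \<open>K\<close>,
  and \<open>K / L\<close> is Hausdorff and first countable, hence metrizable by the Birkhoff-Kakutani theorem.
  Both \<open>g\<close> and the composite of \<open>p\<close> with \<open>K \<rightarrow> K / L\<close> respect the fibers of the quotient maps, so they induce
  \<open>K / L \<rightarrow> M\<close> and \<open>r: H \<rightarrow> K / L\<close> whose composite is \<open>f\<close>.  If \<open>p a\<close> and \<open>p b\<close> lie in the same
  \<open>L\<close>-coset, then some \<open>x\<close> has \<open>p x = p a\<close> and \<open>\<pi> x = \<pi> b\<close>; therefore preimages in \<open>K\<close> of \<open>r\<close>-images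
  are \<open>p\<close>-images of \<open>\<pi>\<close>-preimages, and fibers of \<open>r\<close> are \<open>\<pi>\<close>-images of fibers of \<open>p\<close>.  Hence \<open>r\<close> is
  perfect.
\<close>

section \<open>The Birkhoff-Kakutani theorem\<close>

lemma topological_group_continuous_mult:
  assumes "topological_group G T" "continuous_map X T f" "continuous_map X T g"
  shows "continuous_map X T (\<lambda>x. f x \<otimes>\<^bsub>G\<^esub> g x)"
proof -
  have "continuous_map X (prod_topology T T) (\<lambda>x. (f x, g x))"
    using assms by (intro continuous_map_pairedI)
  moreover have "continuous_map (prod_topology T T) T (\<lambda>(x, y). x \<otimes>\<^bsub>G\<^esub> y)"
    using assms by (simp add: topological_group_def)
  ultimately have "continuous_map X T ((\<lambda>(x, y). x \<otimes>\<^bsub>G\<^esub> y) \<circ> (\<lambda>x. (f x, g x)))"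
    by (rule continuous_map_compose)
  then show ?thesis by (simp add: o_def)
qed

lemma topological_group_continuous_inv:
  assumes "topological_group G T" "continuous_map X T f"
  shows "continuous_map X T (\<lambda>x. inv\<^bsub>G\<^esub> (f x))"
  using continuous_map_compose[OF assms(2), of T "\<lambda>x. inv\<^bsub>G\<^esub> x"] assms(1)
  by (simp add: o_def topological_group_def)

text \<open>Continuity of multiplication at the pair of units is used twice: \<open>W\<close>
  multiplies into \<open>U\<close>, and \<open>A\<close> multiplies into \<open>W\<close>.
  Intersecting \<open>A\<close> and \<open>W\<close> with their preimage under inversion makes the
  result symmetric.\<close>

lemma topological_group_cube_neighbourhood:
  assumes TG: "topological_group G T" and U: "openin T U" "\<one>\<^bsub>G\<^esub> \<in> U"
  obtains V where "openin T V" "\<one>\<^bsub>G\<^esub> \<in> V" "\<And>x. x \<in> V \<Longrightarrow> inv\<^bsub>G\<^esub> x \<in> V" "V <#>\<^bsub>G\<^esub> (V <#>\<^bsub>G\<^esub> V) \<subseteq> U"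
proof -
  have top: "topspace T = carrier G" using TG by (simp add: topological_group_def)
  interpret group G using TG by (simp add: topological_group_def)
  have square: "\<exists>W. openin T W \<and> \<one>\<^bsub>G\<^esub> \<in> W \<and> (\<forall>x\<in>W. \<forall>y\<in>W. x \<otimes>\<^bsub>G\<^esub> y \<in> U)"
    if "openin T U" "\<one>\<^bsub>G\<^esub> \<in> U" for U
  proof -
    have "continuous_map (prod_topology T T) T (\<lambda>z. fst z \<otimes>\<^bsub>G\<^esub> snd z)"
      by (intro topological_group_continuous_mult[OF TG] continuous_map_fst continuous_map_snd)
    then have "openin (prod_topology T T) {z \<in> topspace (prod_topology T T). fst z \<otimes>\<^bsub>G\<^esub> snd z \<in> U}"
      using that(1) by (rule openin_continuous_map_preimage)
    note this[unfolded openin_prod_topology_alt, rule_format]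
    moreover have "(\<one>\<^bsub>G\<^esub>, \<one>\<^bsub>G\<^esub>) \<in> {z \<in> topspace (prod_topology T T). fst z \<otimes>\<^bsub>G\<^esub> snd z \<in> U}"
      using that by (simp add: top)
    ultimately obtain A B where AB: "openin T A" "openin T B" "\<one>\<^bsub>G\<^esub> \<in> A" "\<one>\<^bsub>G\<^esub> \<in> B"
      "A \<times> B \<subseteq> {z \<in> topspace (prod_topology T T). fst z \<otimes>\<^bsub>G\<^esub> snd z \<in> U}"
      by meson
    show ?thesis
    proof (intro exI conjI ballI)
      show "openin T (A \<inter> B)" "\<one>\<^bsub>G\<^esub> \<in> A \<inter> B" using AB by auto
      fix x y assume "x \<in> A \<inter> B" "y \<in> A \<inter> B"
      then have "(x, y) \<in> A \<times> B" by blast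
      then show "x \<otimes>\<^bsub>G\<^esub> y \<in> U" using AB(5) by auto
    qed
  qed
  obtain W where W: "openin T W" "\<one>\<^bsub>G\<^esub> \<in> W" "\<forall>x\<in>W. \<forall>y\<in>W. x \<otimes>\<^bsub>G\<^esub> y \<in> U"
    using square[OF U] by blast
  obtain A where A: "openin T A" "\<one>\<^bsub>G\<^esub> \<in> A" "\<forall>x\<in>A. \<forall>y\<in>A. x \<otimes>\<^bsub>G\<^esub> y \<in> W"
    using square[OF W(1,2)] by blast
  define V where "V = A \<inter> W \<inter> {x \<in> topspace T. inv\<^bsub>G\<^esub> x \<in> A \<inter> W}"
  show thesis
  proof (rule that[of V])
    have "continuous_map T T (\<lambda>x. inv\<^bsub>G\<^esub> x)" using TG by (simp add: topological_group_def)
    then have "openin T {x \<in> topspace T. inv\<^bsub>G\<^esub> x \<in> A \<inter> W}"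
      by (rule openin_continuous_map_preimage) (use A W in blast)
    then show "openin T V" unfolding V_def using A W by blast
    show "\<one>\<^bsub>G\<^esub> \<in> V" using A W by (simp add: V_def top)
    show "\<And>x. x \<in> V \<Longrightarrow> inv\<^bsub>G\<^esub> x \<in> V" by (simp add: V_def top)
    show "V <#>\<^bsub>G\<^esub> (V <#>\<^bsub>G\<^esub> V) \<subseteq> U" using A W by (auto simp: V_def set_mult_def)
  qed
qed

section \<open>Words over a neighbourhood sequence and their infimum norm\<close>

text \<open>Cut at the first element after which less than \<open>t\<close> remains. If the prefix
  is nonempty, the suffix beginning at that element still sums to at least \<open>t\<close>, which
  leaves less than \<open>s\<close> for the prefix; an empty prefix sums to 0.\<close>

lemma sum_list_split_lt:
  fixes f :: "'a \<Rightarrow> real"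
  assumes "sum_list (map f xs) < s + t" "0 < s" "0 < t" "xs \<noteq> []"
  obtains ys x zs where "xs = ys @ x # zs" "sum_list (map f ys) < s" "sum_list (map f zs) < t"
  using assms
proof (induction xs arbitrary: s thesis)
  case (Cons a xs)
  show ?case
  proof (cases "sum_list (map f xs) < t")
    case True
    then show ?thesis using Cons.prems(1)[of "[]" a xs] Cons.prems by simp
  next
    case False
    then have "xs \<noteq> []" "f a < s" "sum_list (map f xs) < (s - f a) + t"
      using Cons.prems by auto
    then obtain ys x zs where "xs = ys @ x # zs" "sum_list (map f ys) < s - f a"
        "sum_list (map f zs) < t"
      using Cons.IH[of "s - f a"] Cons.prems by auto
    then show ?thesis using Cons.prems(1)[of "a # ys" x zs] by simp
  qed
qed simp

text \<open>
  The norm of \<open>x\<close> is the infimum of \<open>2\<^sup>-\<^sup>n\<^sup>1 + \<dots> + 2\<^sup>-\<^sup>n\<^sup>k\<close> over all products \<open>U\<^sub>n\<^sub>1 \<cdots> U\<^sub>n\<^sub>k\<close>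
  containing \<open>x\<close>; the metric will be \<open>d x y = \<parallel>x\<inverse> y\<parallel>\<close>.
\<close>

primrec word_set :: "('a, 'm) monoid_scheme \<Rightarrow> (nat \<Rightarrow> 'a set) \<Rightarrow> nat list \<Rightarrow> 'a set" where
  "word_set G U [] = {\<one>\<^bsub>G\<^esub>}"
| "word_set G U (n # ns) = U n <#>\<^bsub>G\<^esub> word_set G U ns"

definition word_weight :: "nat list \<Rightarrow> real" where
  "word_weight ns = sum_list (map (\<lambda>n. (1/2) ^ n) ns)"

definition word_norm :: "('a, 'm) monoid_scheme \<Rightarrow> (nat \<Rightarrow> 'a set) \<Rightarrow> 'a \<Rightarrow> real" where
  "word_norm G U x = Inf (word_weight ` {ns. x \<in> word_set G U ns})"

lemma word_weight_nonneg: "0 \<le> word_weight ns"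
  unfolding word_weight_def by (intro sum_list_nonneg) auto

text \<open>The algebraic part of the metrization argument, free of any topology. By
  \<open>U_zero\<close> every element has the one-letter word \<open>[0]\<close>, so the infimum
  defining its norm ranges over a nonempty set.\<close>

locale neighbourhood_sequence = group G for G (structure) +
  fixes U :: "nat \<Rightarrow> 'a set"
  assumes U_zero: "U 0 = carrier G"
    and U_carrier: "U n \<subseteq> carrier G"
    and U_one: "\<one> \<in> U n"
    and U_inv: "x \<in> U n \<Longrightarrow> inv x \<in> U n"
    and U_cube: "U (Suc n) <#> (U (Suc n) <#> U (Suc n)) \<subseteq> U n"
begin

text \<open>An element of \<open>U (Suc n)\<close> becomes a triple product once padded with two
  units, so the cube condition also yields monotonicity.\<close>

lemma U_antimono:
  assumes "m \<le> n"
  shows "U n \<subseteq> U m"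
proof -
  have "U (Suc n) \<subseteq> U n" for n
  proof
    fix x assume x: "x \<in> U (Suc n)"
    then have "\<one> \<otimes> (\<one> \<otimes> x) \<in> U (Suc n) <#> (U (Suc n) <#> U (Suc n))"
      unfolding set_mult_def using U_one by blast
    moreover have "x \<in> carrier G" using x U_carrier by blast
    ultimately show "x \<in> U n" using U_cube by auto
  qed
  then show ?thesis by (rule lift_Suc_antimono_le) (rule assms)
qed

lemma word_set_carrier: "word_set G U ns \<subseteq> carrier G"
proof (induction ns)
  case (Cons n ns)
  then show ?case using set_mult_closed[OF U_carrier[of n] Cons.IH] by simp
qed simp

lemma word_set_append: "word_set G U (ms @ ns) = word_set G U ms <#> word_set G U ns"
proof (induction ms)
  case Nil
  then show ?case using word_set_carrier[of ns] by (force simp: set_mult_def)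
next
  case (Cons m ms)
  then show ?case by (simp add: set_mult_assoc U_carrier word_set_carrier)
qed

lemma word_set_singleton: "word_set G U [n] = U n"
  using U_carrier[of n] by (force simp: set_mult_def)

text \<open>Inversion reverses the order of the factors and keeps each letter, because every
  \<open>U n\<close> is symmetric.\<close>

lemma word_set_inv:
  assumes "x \<in> word_set G U ns"
  shows "inv x \<in> word_set G U (rev ns)"
  using assms
proof (induction ns arbitrary: x)
  case (Cons n ns)
  then obtain u y where uy: "u \<in> U n" "y \<in> word_set G U ns" "x = u \<otimes> y"
    by (auto simp: set_mult_def)
  then have c: "u \<in> carrier G" "y \<in> carrier G" using U_carrier word_set_carrier by blast+
  have "inv u \<in> word_set G U [n]" unfolding word_set_singleton by (rule U_inv[OF uy(1)])
  moreover have "inv x = inv y \<otimes> inv u" using uy c by (simp add: inv_mult_group)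
  ultimately show ?case
    using Cons.IH[OF uy(2)] unfolding rev.simps word_set_append set_mult_def by blast
qed simp

text \<open>
  A word of weight below \<open>2\<^sup>-\<^sup>m\<close> splits into two words of weight below \<open>2\<^sup>-\<^sup>m\<^sup>-\<^sup>1\<close> around one letter,
  whose index exceeds \<open>m\<close>; this is where \<open>U_cube\<close> is needed.
\<close>

lemma word_set_subset:
  assumes "word_weight ns < (1/2) ^ m"
  shows "word_set G U ns \<subseteq> U m"
  using assms
proof (induction "length ns" arbitrary: ns m rule: less_induct)
  case less
  show ?case
  proof (cases "ns = []")
    case False
    have "word_weight ns < (1/2) ^ Suc m + (1/2) ^ Suc m" using less.prems by simp
    then obtain xs k ys where split: "ns = xs @ k # ys"
      and xs: "word_weight xs < (1/2) ^ Suc m" and ys: "word_weight ys < (1/2) ^ Suc m"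
      using sum_list_split_lt[of "\<lambda>n. (1/2) ^ n" ns "(1/2) ^ Suc m" "(1/2) ^ Suc m"] False
      unfolding word_weight_def by auto
    have "(1/2) ^ k \<le> word_weight ns"
      using word_weight_nonneg[of xs] word_weight_nonneg[of ys] by (simp add: split word_weight_def)
    then have "(1/2::real) ^ k < (1/2) ^ m" using less.prems by linarith
    then have "Suc m \<le> k" by (simp add: power_strict_decreasing_iff)
    then have "U k \<subseteq> U (Suc m)" by (rule U_antimono)
    moreover have "word_set G U xs \<subseteq> U (Suc m)" "word_set G U ys \<subseteq> U (Suc m)"
      using less.hyps[OF _ xs] less.hyps[OF _ ys] by (auto simp: split)
    ultimately have "word_set G U ns \<subseteq> U (Suc m) <#> (U (Suc m) <#> U (Suc m))"
      unfolding split word_set_append word_set.simps by (intro mono_set_mult)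
    then show ?thesis using U_cube by blast
  qed (simp add: U_one)
qed

lemma word_norm_le: "x \<in> word_set G U ns \<Longrightarrow> word_norm G U x \<le> word_weight ns"
  unfolding word_norm_def
  by (rule cInf_lower) (auto intro!: bdd_belowI[of _ 0] word_weight_nonneg)

lemma word_norm_le_of_mem: "x \<in> U n \<Longrightarrow> word_norm G U x \<le> (1/2) ^ n"
  using word_norm_le[of x "[n]"] unfolding word_set_singleton by (simp add: word_weight_def)

lemma word_norm_witness:
  assumes "x \<in> carrier G" "word_norm G U x < e"
  obtains ns where "x \<in> word_set G U ns" "word_weight ns < e"
proof -
  have "x \<in> word_set G U [0]" unfolding word_set_singleton U_zero by (rule assms(1))
  then have "word_weight ` {ns. x \<in> word_set G U ns} \<noteq> {}" by blast
  from cInf_lessD[OF this] that show thesis using assms(2) unfolding word_norm_def by blast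
qed

text \<open>With \<open>word_norm_le_of_mem\<close> this interleaves the sets \<open>U n\<close>
  with norm balls around the unit: radius \<open>(1/2) ^ n\<close> open inside, closed outside.
  Hence both describe the same neighbourhoods of the unit.\<close>

lemma mem_of_word_norm_lt: "x \<in> carrier G \<Longrightarrow> word_norm G U x < (1/2) ^ n \<Longrightarrow> x \<in> U n"
  using word_norm_witness word_set_subset by blast

lemma word_norm_nonneg:
  assumes "x \<in> carrier G"
  shows "0 \<le> word_norm G U x"
  using word_norm_witness[OF assms, of 0] word_weight_nonneg by (meson not_le)

lemma word_norm_one: "word_norm G U \<one> = 0"
  using word_norm_le[of \<one> "[]"] word_norm_nonneg[of \<one>] by (simp add: word_weight_def)

text \<open>A nearly optimal word for \<open>x\<close>, reversed, is a word of equal weight for the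
  inverse. Applying this inequality to \<open>x\<close> and to its inverse gives equality.\<close>

lemma word_norm_inv:
  assumes x: "x \<in> carrier G"
  shows "word_norm G U (inv x) = word_norm G U x"
proof -
  have le: "word_norm G U (inv x) \<le> word_norm G U x" if x: "x \<in> carrier G" for x
  proof (rule field_le_epsilon)
    fix e :: real assume "0 < e"
    then obtain ns where ns: "x \<in> word_set G U ns" "word_weight ns < word_norm G U x + e"
      using word_norm_witness[OF x, of "word_norm G U x + e"] by auto
    have "word_norm G U (inv x) \<le> word_weight (rev ns)"
      by (rule word_norm_le[OF word_set_inv[OF ns(1)]])
    also have "word_weight (rev ns) = word_weight ns"
      unfolding word_weight_def rev_map[symmetric] by (rule sum_list_rev)
    finally show "word_norm G U (inv x) \<le> word_norm G U x + e" using ns(2) by linarith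
  qed
  show ?thesis using le[OF x] le[of "inv x"] x by simp
qed

text \<open>Concatenating nearly optimal words adds their weights.\<close>

lemma word_norm_mult:
  assumes x: "x \<in> carrier G" and y: "y \<in> carrier G"
  shows "word_norm G U (x \<otimes> y) \<le> word_norm G U x + word_norm G U y"
proof (rule field_le_epsilon)
  fix e :: real assume "0 < e"
  then obtain ms ns where ms: "x \<in> word_set G U ms" "word_weight ms < word_norm G U x + e/2"
    and ns: "y \<in> word_set G U ns" "word_weight ns < word_norm G U y + e/2"
    using word_norm_witness[OF x, of "word_norm G U x + e/2"]
      word_norm_witness[OF y, of "word_norm G U y + e/2"]
    by (metis half_gt_zero less_add_same_cancel1)
  have "x \<otimes> y \<in> word_set G U (ms @ ns)"
    using ms ns by (auto simp: word_set_append set_mult_def)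
  then have "word_norm G U (x \<otimes> y) \<le> word_weight (ms @ ns)" by (rule word_norm_le)
  then show "word_norm G U (x \<otimes> y) \<le> word_norm G U x + word_norm G U y + e"
    using ms ns by (simp add: word_weight_def)
qed

end

section \<open>From the norm to a left-invariant metric\<close>

text \<open>A countable base at the unit is refined to a neighbourhood sequence. Its norm gives a
  left-invariant metric, so comparing the two topologies reduces by left translation to
  neighbourhoods of the unit.\<close>

lemma birkhoff_kakutani:
  assumes TG: "topological_group G T" and fc: "first_countable T"
  shows "metrizable_space T"
proof -
  have top: "topspace T = carrier G" and haus: "Hausdorff_space T"
    using TG by (auto simp: topological_group_def)
  interpret group G using TG by (simp add: topological_group_def)
  obtain B where B: "countable B" "\<forall>V\<in>B. openin T V"
      "\<forall>U. openin T U \<and> \<one>\<^bsub>G\<^esub> \<in> U \<longrightarrow> (\<exists>V\<in>B. \<one>\<^bsub>G\<^esub> \<in> V \<and> V \<subseteq> U)"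
    using fc unfolding first_countable_def top by (meson one_closed)
  define B' where "B' = {V\<in>B. \<one>\<^bsub>G\<^esub> \<in> V}"
  have "B' \<noteq> {}" using B(3) openin_topspace[of T] by (auto simp: B'_def top)
  moreover have "countable B'" using B(1) by (simp add: B'_def)
  ultimately have range: "range (from_nat_into B') = B'" by (rule range_from_nat_into)
  define b where "b = from_nat_into B'"
  have b: "openin T (b n)" "\<one>\<^bsub>G\<^esub> \<in> b n" for n
    using range B(2) by (auto simp: b_def B'_def)
  \<comment> \<open>The index matters only at 0, where it forces the whole group as
    \<open>U_zero\<close> demands. Intersecting with \<open>b n\<close> in the recursion step makes
    the sequence refine the countable base.\<close>
  define P where "P n U \<longleftrightarrow> (n = 0 \<longrightarrow> U = carrier G) \<and> openin T U \<and> \<one>\<^bsub>G\<^esub> \<in> U \<and> (\<forall>x\<in>U. inv\<^bsub>G\<^esub> x \<in> U)"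
    for n :: nat and U
  have "\<exists>U. \<forall>n. P n (U n) \<and> U (Suc n) <#>\<^bsub>G\<^esub> (U (Suc n) <#>\<^bsub>G\<^esub> U (Suc n)) \<subseteq> U n \<inter> b n"
  proof (rule dependent_nat_choice)
    show "\<exists>U. P 0 U" using openin_topspace[of T] by (auto simp: P_def top)
    fix U n assume "P n U"
    then have "openin T (U \<inter> b n)" "\<one>\<^bsub>G\<^esub> \<in> U \<inter> b n" using b by (auto simp: P_def)
    from topological_group_cube_neighbourhood[OF TG this]
    show "\<exists>V. P (Suc n) V \<and> V <#>\<^bsub>G\<^esub> (V <#>\<^bsub>G\<^esub> V) \<subseteq> U \<inter> b n"
      unfolding P_def by (metis nat.distinct(1))
  qed
  then obtain U where U: "\<And>n. P n (U n)"
    and cube: "\<And>n. U (Suc n) <#>\<^bsub>G\<^esub> (U (Suc n) <#>\<^bsub>G\<^esub> U (Suc n)) \<subseteq> U n \<inter> b n"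
    by blast
  interpret neighbourhood_sequence G U
  proof
    show "U n \<subseteq> carrier G" for n
      using U openin_subset top unfolding P_def by metis
  qed (use U cube in \<open>auto simp: P_def\<close>)
  have base: "\<exists>n. U n \<subseteq> V" if V: "openin T V" "\<one>\<^bsub>G\<^esub> \<in> V" for V
  proof -
    obtain W where "W \<in> B'" "W \<subseteq> V" using B(3) V by (auto simp: B'_def)
    then obtain n where "b n \<subseteq> V" using range by (metis b_def rangeE)
    moreover have "x \<in> b n" if x: "x \<in> U (Suc n)" for x
    proof -
      have "\<one>\<^bsub>G\<^esub> \<otimes>\<^bsub>G\<^esub> (\<one>\<^bsub>G\<^esub> \<otimes>\<^bsub>G\<^esub> x) \<in> U (Suc n) <#>\<^bsub>G\<^esub> (U (Suc n) <#>\<^bsub>G\<^esub> U (Suc n))"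
        unfolding set_mult_def using x U_one by blast
      moreover have "x \<in> carrier G" using x U_carrier by blast
      ultimately show ?thesis using cube by auto
    qed
    ultimately show ?thesis by blast
  qed
  \<comment> \<open>This is where the Hausdorff property enters: an element of norm 0 lies in every
    \<open>U n\<close>, hence in every neighbourhood of the unit.\<close>
  have sep: "x = \<one>\<^bsub>G\<^esub>" if x: "x \<in> carrier G" and N0: "word_norm G U x = 0" for x
  proof (rule ccontr)
    assume "x \<noteq> \<one>\<^bsub>G\<^esub>"
    then obtain V where "openin T V" "\<one>\<^bsub>G\<^esub> \<in> V" "x \<notin> V"
      using haus x unfolding Hausdorff_space_def top disjnt_iff by (metis one_closed)
    then show False using base mem_of_word_norm_lt[OF x] N0 by fastforce
  qed
  \<comment> \<open>Outside the carrier the norm is the junk value \<open>Inf {}\<close>, while \<^locale>\<open>Metric_space\<close>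
    demands nonnegativity and symmetry everywhere.\<close>
  define d where "d x y = (if x \<in> carrier G \<and> y \<in> carrier G then word_norm G U (inv\<^bsub>G\<^esub> x \<otimes>\<^bsub>G\<^esub> y) else 0)"
    for x y
  interpret M: Metric_space "carrier G" d
  proof
    show "0 \<le> d x y" for x y by (simp add: d_def word_norm_nonneg)
    show "d x y = d y x" for x y
      using word_norm_inv[of "inv\<^bsub>G\<^esub> x \<otimes>\<^bsub>G\<^esub> y"] by (auto simp: d_def inv_mult_group)
    show "d x y = 0 \<longleftrightarrow> x = y" if "x \<in> carrier G" "y \<in> carrier G" for x y
      using that sep[of "inv\<^bsub>G\<^esub> x \<otimes>\<^bsub>G\<^esub> y"] inv_solve_left'[of "\<one>\<^bsub>G\<^esub>" x y] by (auto simp: d_def word_norm_one)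
    show "d x z \<le> d x y + d y z" if "x \<in> carrier G" "y \<in> carrier G" "z \<in> carrier G" for x y z
    proof -
      have "inv\<^bsub>G\<^esub> x \<otimes>\<^bsub>G\<^esub> z = (inv\<^bsub>G\<^esub> x \<otimes>\<^bsub>G\<^esub> y) \<otimes>\<^bsub>G\<^esub> (inv\<^bsub>G\<^esub> y \<otimes>\<^bsub>G\<^esub> z)"
        using that by (simp add: m_assoc) (simp add: m_assoc[symmetric])
      then show ?thesis
        using that word_norm_mult[of "inv\<^bsub>G\<^esub> x \<otimes>\<^bsub>G\<^esub> y" "inv\<^bsub>G\<^esub> y \<otimes>\<^bsub>G\<^esub> z"] by (simp add: d_def)
    qed
  qed
  have "openin T V \<longleftrightarrow> openin M.mtopology V" for V
  proof
    assume V: "openin T V"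
    have VC: "V \<subseteq> carrier G" using V openin_subset top by blast
    show "openin M.mtopology V"
      unfolding M.openin_mtopology
    proof (intro conjI VC allI impI)
      fix x assume x: "x \<in> V"
      then have xc: "x \<in> carrier G" using VC by blast
      \<comment> \<open>Translating \<open>V\<close> back by \<open>x\<close> gives a neighbourhood
        of the unit, which contains some \<open>U n\<close>; the ball around \<open>x\<close> is the
        translate of a norm ball inside that \<open>U n\<close>.\<close>
      have "continuous_map T T (\<lambda>y. x \<otimes>\<^bsub>G\<^esub> y)"
        using xc by (intro topological_group_continuous_mult[OF TG]) (auto simp: top)
      then have "openin T {y \<in> topspace T. x \<otimes>\<^bsub>G\<^esub> y \<in> V}"
        using V by (rule openin_continuous_map_preimage)
      then obtain n where n: "U n \<subseteq> {y \<in> topspace T. x \<otimes>\<^bsub>G\<^esub> y \<in> V}"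
        using base[of "{y \<in> topspace T. x \<otimes>\<^bsub>G\<^esub> y \<in> V}"] x xc by (auto simp: top)
      have "y \<in> V" if y: "y \<in> M.mball x ((1/2) ^ n)" for y
      proof -
        have yc: "y \<in> carrier G" and "word_norm G U (inv\<^bsub>G\<^esub> x \<otimes>\<^bsub>G\<^esub> y) < (1/2) ^ n"
          using y xc by (auto simp: d_def)
        then have "inv\<^bsub>G\<^esub> x \<otimes>\<^bsub>G\<^esub> y \<in> U n" using mem_of_word_norm_lt xc by simp
        then have "x \<otimes>\<^bsub>G\<^esub> (inv\<^bsub>G\<^esub> x \<otimes>\<^bsub>G\<^esub> y) \<in> V" using n by blast
        then show ?thesis using xc yc by (simp add: m_assoc[symmetric])
      qed
      then show "\<exists>r>0. M.mball x r \<subseteq> V"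
        by (intro exI[of _ "(1/2) ^ n"]) auto
    qed
  next
    assume V: "openin M.mtopology V"
    show "openin T V"
    proof (subst openin_subopen, intro ballI)
      fix x assume "x \<in> V"
      then obtain r where r: "r > 0" "M.mball x r \<subseteq> V" and xc: "x \<in> carrier G"
        using V unfolding M.openin_mtopology by blast
      obtain n where n: "(1/2) ^ n < r" using real_arch_pow_inv[OF r(1), of "1/2"] by auto
      \<comment> \<open>The left translate of \<open>U n\<close> by \<open>x\<close>. Its points are
        at distance at most \<open>(1/2) ^ n\<close> from \<open>x\<close>, so the strict bound by
        \<open>r\<close> puts it inside the ball.\<close>
      define W where "W = {y \<in> topspace T. inv\<^bsub>G\<^esub> x \<otimes>\<^bsub>G\<^esub> y \<in> U n}"
      have "continuous_map T T (\<lambda>y. inv\<^bsub>G\<^esub> x \<otimes>\<^bsub>G\<^esub> y)"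
        using xc by (intro topological_group_continuous_mult[OF TG]) (auto simp: top)
      then have "openin T W"
        unfolding W_def by (rule openin_continuous_map_preimage) (use U in \<open>simp add: P_def\<close>)
      moreover have "x \<in> W" using xc U_one by (simp add: W_def top)
      moreover have "y \<in> V" if "y \<in> W" for y
        using that r n xc word_norm_le_of_mem[of "inv\<^bsub>G\<^esub> x \<otimes>\<^bsub>G\<^esub> y" n]
        by (force simp: W_def top d_def)
      ultimately show "\<exists>W. openin T W \<and> x \<in> W \<and> W \<subseteq> V" by blast
    qed
  qed
  then have "T = M.mtopology" by (simp add: topology_eq)
  then show ?thesis using M.metrizable_space_mtopology by simp
qed

section \<open>Quotients of topological groups\<close>

text \<open>The final topology along \<open>q\<close>, which will topologize the set of
  cosets.\<close>

lemma exists_quotient_topology: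
  obtains Y where "topspace Y = q ` topspace X" "quotient_map X Y q"
proof -
  define Y where "Y = topology (\<lambda>U. U \<subseteq> q ` topspace X \<and> openin X {x \<in> topspace X. q x \<in> U})"
  have "istopology (\<lambda>U. U \<subseteq> q ` topspace X \<and> openin X {x \<in> topspace X. q x \<in> U})"
    unfolding istopology_def
  proof (intro conjI allI impI; (elim conjE)?)
    fix A B assume "openin X {x \<in> topspace X. q x \<in> A}" "openin X {x \<in> topspace X. q x \<in> B}"
    then have "openin X ({x \<in> topspace X. q x \<in> A} \<inter> {x \<in> topspace X. q x \<in> B})"
      by (rule openin_Int)
    then show "openin X {x \<in> topspace X. q x \<in> A \<inter> B}"
      by (rule back_subst[of "openin X"]) blast
  next
    fix \<K> assume "\<forall>K\<in>\<K>. K \<subseteq> q ` topspace X \<and> openin X {x \<in> topspace X. q x \<in> K}"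
    then have "openin X (\<Union>K\<in>\<K>. {x \<in> topspace X. q x \<in> K})" by blast
    then show "openin X {x \<in> topspace X. q x \<in> \<Union> \<K>}"
      by (rule back_subst[of "openin X"]) blast
  qed blast+
  then have op: "openin Y U \<longleftrightarrow> U \<subseteq> q ` topspace X \<and> openin X {x \<in> topspace X. q x \<in> U}" for U
    by (simp add: Y_def)
  have "openin Y (q ` topspace X)"
    unfolding op by (metis (mono_tags, lifting) Collect_cong Collect_mem_eq imageI openin_topspace order_refl)
  then have top: "topspace Y = q ` topspace X"
    using op[of "topspace Y"] openin_subset[of Y "q ` topspace X"] by auto
  show thesis by (rule that[OF top]) (auto simp: quotient_map_def top op)
qed

text \<open>Images of open boxes are open boxes. This is needed to make the square of a quotient
  homomorphism a quotient map.\<close>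

lemma open_map_prod_map:
  assumes f: "open_map X X' f" and g: "open_map Y Y' g"
  shows "open_map (prod_topology X Y) (prod_topology X' Y') (\<lambda>z. (f (fst z), g (snd z)))"
  unfolding open_map_def
proof (intro allI impI)
  fix W assume W: "openin (prod_topology X Y) W"
  show "openin (prod_topology X' Y') ((\<lambda>z. (f (fst z), g (snd z))) ` W)"
    unfolding openin_prod_topology_alt
  proof (intro allI impI)
    fix x y assume "(x, y) \<in> (\<lambda>z. (f (fst z), g (snd z))) ` W"
    then obtain a b where ab: "(a, b) \<in> W" "x = f a" "y = g b" by auto
    obtain U V where UV: "openin X U" "openin Y V" "a \<in> U" "b \<in> V" "U \<times> V \<subseteq> W"
      using W[unfolded openin_prod_topology_alt, rule_format, OF ab(1)] by meson
    have "openin X' (f ` U)" "openin Y' (g ` V)"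
      using f g UV by (auto simp: open_map_def)
    moreover have "f ` U \<times> g ` V \<subseteq> (\<lambda>z. (f (fst z), g (snd z))) ` W"
    proof clarify
      fix u v assume "u \<in> U" "v \<in> V"
      then have "(u, v) \<in> W" using UV(5) by blast
      then show "(f u, g v) \<in> (\<lambda>z. (f (fst z), g (snd z))) ` W" by (rule rev_image_eqI) simp
    qed
    moreover have "x \<in> f ` U" "y \<in> g ` V" using ab(2,3) UV(3,4) by auto
    ultimately show "\<exists>A B. openin X' A \<and> openin Y' B \<and> x \<in> A \<and> y \<in> B \<and>
        A \<times> B \<subseteq> (\<lambda>z. (f (fst z), g (snd z))) ` W"
      by (intro exI conjI)
  qed
qed

lemma quotient_topological_group:
  assumes TG: "topological_group G T" and Q: "group Q" and q: "q \<in> hom G Q"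
    and quot: "quotient_map T S q" and topS: "topspace S = carrier Q"
    and ker: "closedin T (kernel G Q q)"
  shows "open_map T S q" "topological_group Q S"
proof -
  have top: "topspace T = carrier G" using TG by (simp add: topological_group_def)
  have G: "group G" using TG by (simp add: topological_group_def)
  interpret group_hom G Q q using G Q q by (simp add: group_hom_def group_hom_axioms_def)
  have onto: "q ` carrier G = carrier Q" using quot top topS by (simp add: quotient_map_def)
  have qc: "continuous_map T S q" by (rule quotient_imp_continuous_map[OF quot])
  show opn: "open_map T S q"
    unfolding open_map_def
  proof (intro allI impI)
    fix U assume U: "openin T U"
    have UC: "U \<subseteq> carrier G" using U openin_subset top by blast
    have "openin T {x \<in> topspace T. x \<otimes>\<^bsub>G\<^esub> n \<in> U}" if "n \<in> kernel G Q q" for n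
    proof (rule openin_continuous_map_preimage[OF _ U])
      show "continuous_map T T (\<lambda>x. x \<otimes>\<^bsub>G\<^esub> n)"
        using that by (intro topological_group_continuous_mult[OF TG]) (auto simp: top kernel_def)
    qed
    then have "openin T (\<Union>n\<in>kernel G Q q. {x \<in> topspace T. x \<otimes>\<^bsub>G\<^esub> n \<in> U})" by blast
    \<comment> \<open>The saturation of \<open>U\<close> is the union of its translates by kernel
      elements, hence open; this is why the quotient map is open.\<close>
    moreover have "(\<Union>n\<in>kernel G Q q. {x \<in> topspace T. x \<otimes>\<^bsub>G\<^esub> n \<in> U}) = {x \<in> topspace T. q x \<in> q ` U}"
      (is "?L = ?R")
    proof
      show "?L \<subseteq> ?R"
      proof
        fix x assume "x \<in> ?L"
        then obtain n where n: "n \<in> kernel G Q q" "x \<in> topspace T" "x \<otimes>\<^bsub>G\<^esub> n \<in> U" by blast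
        then have "q (x \<otimes>\<^bsub>G\<^esub> n) = q x" by (simp add: kernel_def top)
        then show "x \<in> ?R" using n by (metis (mono_tags, lifting) imageI mem_Collect_eq)
      qed
      show "?R \<subseteq> ?L"
      proof
        fix x assume "x \<in> ?R"
        then obtain u where x: "x \<in> topspace T" and u: "u \<in> U" and eq: "q x = q u" by blast
        have "x \<in> carrier G" "u \<in> carrier G" using x u UC top by auto
        then have "inv\<^bsub>G\<^esub> x \<otimes>\<^bsub>G\<^esub> u \<in> kernel G Q q" "x \<otimes>\<^bsub>G\<^esub> (inv\<^bsub>G\<^esub> x \<otimes>\<^bsub>G\<^esub> u) = u"
          using eq by (auto simp: kernel_def G.m_assoc[symmetric])
        then show "x \<in> ?L" using x u by force
      qed
    qed
    ultimately show "openin S (q ` U)"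
      using quot UC onto topS unfolding quotient_map_def by (metis image_mono)
  qed
  define qq where "qq z = (q (fst z), q (snd z))" for z
  have qq_open: "open_map (prod_topology T T) (prod_topology S S) qq"
    unfolding qq_def by (rule open_map_prod_map[OF opn opn])
  have "continuous_map (prod_topology T T) (prod_topology S S) qq"
    unfolding qq_def
    by (intro continuous_map_pairedI continuous_map_compose[OF continuous_map_fst qc, unfolded o_def]
        continuous_map_compose[OF continuous_map_snd qc, unfolded o_def])
  moreover have qq_onto: "qq ` topspace (prod_topology T T) = topspace (prod_topology S S)"
  proof -
    have "qq ` (A \<times> B) = q ` A \<times> q ` B" for A B by (force simp: qq_def)
    then show ?thesis by (simp add: top topS onto)
  qed
  \<comment> \<open>Products of quotient maps need not be quotient maps; openness of
    \<open>q\<close> makes \<open>qq\<close> one. Continuity of multiplication and closedness of the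
    diagonal can then be tested upstairs.\<close>
  ultimately have qq: "quotient_map (prod_topology T T) (prod_topology S S) qq"
    using qq_open by (intro continuous_open_imp_quotient_map)
  have "continuous_map (prod_topology T T) S ((\<lambda>(x, y). x \<otimes>\<^bsub>Q\<^esub> y) \<circ> qq)"
  proof (rule continuous_map_eq)
    show "continuous_map (prod_topology T T) S (q \<circ> (\<lambda>z. fst z \<otimes>\<^bsub>G\<^esub> snd z))"
      by (rule continuous_map_compose[OF _ qc])
        (intro topological_group_continuous_mult[OF TG] continuous_map_fst continuous_map_snd)
  qed (auto simp: qq_def top)
  then have mult: "continuous_map (prod_topology S S) S (\<lambda>(x, y). x \<otimes>\<^bsub>Q\<^esub> y)"
    using continuous_compose_quotient_map_eq[OF qq] by blast
  have "continuous_map T S ((\<lambda>x. inv\<^bsub>Q\<^esub> x) \<circ> q)"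
  proof (rule continuous_map_eq)
    show "continuous_map T S (q \<circ> (\<lambda>x. inv\<^bsub>G\<^esub> x))"
      by (rule continuous_map_compose[OF _ qc]) (use TG in \<open>simp add: topological_group_def\<close>)
  qed (auto simp: top)
  then have inv: "continuous_map S S (\<lambda>x. inv\<^bsub>Q\<^esub> x)"
    using continuous_compose_quotient_map_eq[OF quot] by blast
  \<comment> \<open>The preimage of the diagonal under \<open>qq\<close> consists of the pairs whose
    right quotient lies in the kernel, so a closed kernel makes \<open>S\<close> Hausdorff.\<close>
  have "continuous_map (prod_topology T T) T (\<lambda>z. fst z \<otimes>\<^bsub>G\<^esub> inv\<^bsub>G\<^esub> (snd z))"
    by (intro topological_group_continuous_mult[OF TG] topological_group_continuous_inv[OF TG]
        continuous_map_fst continuous_map_snd)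
  then have "closedin (prod_topology T T)
      {z \<in> topspace (prod_topology T T). fst z \<otimes>\<^bsub>G\<^esub> inv\<^bsub>G\<^esub> (snd z) \<in> kernel G Q q}"
    using ker by (rule closedin_continuous_map_preimage)
  moreover have "fst z \<otimes>\<^bsub>G\<^esub> inv\<^bsub>G\<^esub> (snd z) \<in> kernel G Q q \<longleftrightarrow> qq z \<in> (\<lambda>x. (x, x)) ` topspace S"
    if "z \<in> topspace (prod_topology T T)" for z
    using that H.inv_solve_right'[of "\<one>\<^bsub>Q\<^esub>" "q (fst z)" "q (snd z)"]
    by (auto simp: kernel_def qq_def top topS image_iff)
  ultimately have "closedin (prod_topology T T)
      {z \<in> topspace (prod_topology T T). qq z \<in> (\<lambda>x. (x, x)) ` topspace S}"
    by (simp cong: conj_cong)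
  moreover have "(\<lambda>x. (x, x)) ` topspace S \<subseteq> topspace (prod_topology S S)" by auto
  ultimately have "Hausdorff_space S"
    unfolding Hausdorff_space_closedin_diagonal
    using qq[unfolded quotient_map_closedin, THEN conjunct2, rule_format] by iprover
  then show "topological_group Q S"
    using mult inv Q topS by (simp add: topological_group_def)
qed

section \<open>Metrizable factor groups\<close>

text \<open>Surjectivity lifts every conjugating element of \<open>H\<close> to \<open>G\<close>, so
  conjugates of image elements are images of conjugates.\<close>

lemma (in group_hom) normal_image:
  assumes N: "N \<lhd> G" and onto: "h ` carrier G = carrier H"
  shows "h ` N \<lhd> H"
proof -
  have sub: "subgroup N G" and conj: "\<And>x n. x \<in> carrier G \<Longrightarrow> n \<in> N \<Longrightarrow> x \<otimes> n \<otimes> inv x \<in> N"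
    using N by (auto simp: G.normal_inv_iff)
  have NC: "N \<subseteq> carrier G" by (rule subgroup.subset[OF sub])
  have "y \<otimes>\<^bsub>H\<^esub> m \<otimes>\<^bsub>H\<^esub> inv\<^bsub>H\<^esub> y \<in> h ` N" if "y \<in> carrier H" "m \<in> h ` N" for y m
  proof -
    obtain x n where xn: "x \<in> carrier G" "y = h x" "n \<in> N" "m = h n"
      using \<open>y \<in> carrier H\<close> \<open>m \<in> h ` N\<close> unfolding onto[symmetric] by blast
    then have "h (x \<otimes> n \<otimes> inv x) = y \<otimes>\<^bsub>H\<^esub> m \<otimes>\<^bsub>H\<^esub> inv\<^bsub>H\<^esub> y" using NC by auto
    then show ?thesis using conj[OF xn(1,3)] by (metis imageI)
  qed
  moreover have "subgroup (h ` N) H" by (rule subgroup_img_is_subgroup[OF sub])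
  ultimately show ?thesis by (simp add: H.normal_inv_iff)
qed

text \<open>The projection is open, so first countability descends to the factor group and
  \<open>birkhoff_kakutani\<close> applies; metrizability need not be pushed down directly.\<close>

lemma metrizable_factor_group:
  assumes TG: "topological_group G T" and met: "metrizable_space T"
    and N: "N \<lhd> G" and closed: "closedin T N"
  obtains S where "topological_group (G Mod N) S" "metrizable_space S"
    "quotient_map T S (\<lambda>x. N #>\<^bsub>G\<^esub> x)"
proof -
  have top: "topspace T = carrier G" using TG by (simp add: topological_group_def)
  interpret normal N G by (rule N)
  let ?q = "\<lambda>x. N #>\<^bsub>G\<^esub> x"
  obtain S where S: "topspace S = ?q ` topspace T" and quot: "quotient_map T S ?q"
    using exists_quotient_topology by blast
  have topS: "topspace S = carrier (G Mod N)" by (simp add: S top carrier_FactGroup)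
  have "kernel G (G Mod N) ?q = N"
    using rcos_const[OF is_group] coset_join1[OF _ _ subgroup_axioms] mem_carrier
    by (auto simp: kernel_def)
  then have "closedin T (kernel G (G Mod N) ?q)" using closed by simp
  note qtg = quotient_topological_group[OF TG factorgroup_is_group r_coset_hom_Mod quot topS this]
  have "first_countable S"
    using qtg(1) quot metrizable_imp_first_countable[OF met] first_countable_open_map_image
    by (metis quotient_imp_continuous_map quotient_imp_surjective_map)
  then have "metrizable_space S" by (rule birkhoff_kakutani[OF qtg(2)])
  then show thesis using that qtg(2) quot by blast
qed

section \<open>Open homomorphic images\<close>

theorem corollary6p8:
  fixes G :: "('a, 'm) monoid_scheme" and T :: "'a topology"
    and H :: "('b, 'n) monoid_scheme" and S :: "'b topology"
    and \<pi> :: "'a \<Rightarrow> 'b"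
  assumes "PSM_factorizable G T"
    and "topological_group H S"
    and "\<pi> \<in> hom G H"
    and "continuous_map T S \<pi>"
    and "open_map T S \<pi>"
    and "\<pi> ` carrier G = carrier H"
  shows "PSM_factorizable H S"
proof (rule PSM_factorizableI[OF assms(2)])
  \<comment> \<open>Two types differ from those in the definition: \<open>M\<close> is over
    \<open>'b set\<close>, while \<open>G\<close> is tested on \<open>'a set\<close>, and the factor
    group of \<open>K\<close> is over \<open>'a set set\<close>. The rules
    \<open>PSM_factorizableD\<close> and \<open>PSM_factorizableI\<close> absorb this.\<close>
  fix M :: "'b set topology" and f
  assume M: "metrizable_space M" and f: "continuous_map S M f"
  have TG: "topological_group G T" using assms(1) by (simp add: PSM_factorizable_def)
  have top: "topspace T = carrier G" "topspace S = carrier H"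
    using TG assms(2) by (auto simp: topological_group_def)
  obtain K :: "'a set monoid" and R p g where K: "topological_group K R" "metrizable_space R"
      and p: "p \<in> hom G K" "perfect_map T R p" and g: "continuous_map R M g"
      and fg: "\<forall>x\<in>carrier G. (f \<circ> \<pi>) x = g (p x)"
    using PSM_factorizableD[OF assms(1) M continuous_map_compose[OF assms(4) f]]
    unfolding perfect_homomorphism_def by blast
  have topR: "topspace R = carrier K" using K by (simp add: topological_group_def)
  have grp: "group G" "group H" "group K"
    using TG assms(2) K by (auto simp: topological_group_def)
  interpret \<pi>: group_hom G H \<pi> using grp assms(3) by (simp add: group_hom_def group_hom_axioms_def)
  interpret p: group_hom G K p using grp p(1) by (simp add: group_hom_def group_hom_axioms_def)
  have pc: "continuous_map T R p" and p_closed: "closed_map T R p"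
    and p_fib: "\<And>y. y \<in> carrier K \<Longrightarrow> compactin T {x \<in> carrier G. p x = y}"
    and p_onto: "p ` carrier G = carrier K"
    using p(2) by (auto simp: perfect_map_def proper_map_def top topR)
  define N where "N = kernel G H \<pi>"
  have NG: "N \<lhd> G" unfolding N_def by (rule \<pi>.normal_kernel)
  have "closedin S {\<one>\<^bsub>H\<^esub>}"
    using assms(2) by (intro closedin_Hausdorff_singleton) (auto simp: topological_group_def)
  from closedin_continuous_map_preimage[OF assms(4) this] have "closedin T N"
    by (simp add: N_def kernel_def top)
  then have "closedin R (p ` N)" using p_closed by (simp add: closed_map_def)
  moreover have pN: "p ` N \<lhd> K" by (rule p.normal_image[OF NG p_onto])
  ultimately obtain Z where Z: "topological_group (K Mod p ` N) Z" "metrizable_space Z"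
    and quot: "quotient_map R Z (\<lambda>x. p ` N #>\<^bsub>K\<^esub> x)"
    using metrizable_factor_group[OF K] by blast
  define q where "q x = p ` N #>\<^bsub>K\<^esub> x" for x
  have quot: "quotient_map R Z q" using quot by (simp add: q_def[abs_def])
  have q_hom: "q \<in> hom K (K Mod p ` N)"
    using normal.r_coset_hom_Mod[OF pN] by (simp add: q_def[abs_def])
  have topZ: "topspace Z = carrier (K Mod p ` N)" using Z by (simp add: topological_group_def)
  have q_onto: "q ` carrier K = topspace Z" using quot by (simp add: quotient_map_def topR)
  have q_eq: "q (p a) = q (p b) \<longleftrightarrow> (\<exists>n\<in>N. p a = p (n \<otimes>\<^bsub>G\<^esub> b))"
    if ab: "a \<in> carrier G" "b \<in> carrier G" for a b
  proof -
    have sub: "subgroup (p ` N) K" using pN by (simp add: normal_def)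
    have NC: "N \<subseteq> carrier G" by (auto simp: N_def kernel_def)
    have "q (p a) = q (p b) \<longleftrightarrow> p a \<in> p ` N #>\<^bsub>K\<^esub> p b"
      unfolding q_def using that sub p.H.repr_independence p.H.repr_independenceD
      by (metis p.hom_closed)
    also have "\<dots> \<longleftrightarrow> (\<exists>n\<in>N. p a = p n \<otimes>\<^bsub>K\<^esub> p b)" by (auto simp: r_coset_def)
    also have "\<dots> \<longleftrightarrow> (\<exists>n\<in>N. p a = p (n \<otimes>\<^bsub>G\<^esub> b))"
      using NC that by (intro bex_cong) auto
    finally show ?thesis .
  qed
  \<comment> \<open>The witness is \<open>b\<close> multiplied by an element \<open>n\<close> of the
    kernel of \<open>\<pi>\<close>: this leaves the \<open>\<pi>\<close>-value unchanged and moves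
    the \<open>p\<close>-value to \<open>p a\<close>.\<close>
  have lift: "\<exists>x\<in>carrier G. p x = p a \<and> \<pi> x = \<pi> b"
    if ab: "a \<in> carrier G" "b \<in> carrier G" and eq: "q (p a) = q (p b)" for a b
  proof -
    obtain n where "n \<in> N" "p a = p (n \<otimes>\<^bsub>G\<^esub> b)" using q_eq[OF ab] eq by blast
    then show ?thesis using ab by (intro bexI[of _ "n \<otimes>\<^bsub>G\<^esub> b"]) (auto simp: N_def kernel_def)
  qed
  have q_resp: "q (p a) = q (p b)"
    if "a \<in> carrier G" "b \<in> carrier G" "\<pi> a = \<pi> b" for a b
  proof -
    have "a \<otimes>\<^bsub>G\<^esub> inv\<^bsub>G\<^esub> b \<in> N" using that by (simp add: N_def kernel_def)
    moreover have "a \<otimes>\<^bsub>G\<^esub> inv\<^bsub>G\<^esub> b \<otimes>\<^bsub>G\<^esub> b = a" using that by (simp add: \<pi>.G.m_assoc)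
    ultimately show ?thesis using q_eq that by metis
  qed
  \<comment> \<open>The lifted \<open>c\<close> shares its \<open>p\<close>-value with
    \<open>a\<close> and its \<open>\<pi>\<close>-value with \<open>b\<close>. Since
    \<open>g\<close> after \<open>p\<close> equals \<open>f\<close> after \<open>\<pi>\<close>, both
    values of \<open>g\<close> agree with the one at \<open>p c\<close>.\<close>
  have g_resp: "g x = g y" if xy: "x \<in> carrier K" "y \<in> carrier K" "q x = q y" for x y
  proof -
    obtain a b where ab: "a \<in> carrier G" "b \<in> carrier G" "x = p a" "y = p b"
      using xy(1,2) unfolding p_onto[symmetric] by blast
    then obtain c where "c \<in> carrier G" "p c = p a" "\<pi> c = \<pi> b" using lift[of a b] xy(3) by auto
    then show ?thesis using bspec[OF fg, of c] bspec[OF fg, of b] ab by simp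
  qed
  have \<pi>_quot: "quotient_map T S \<pi>"
    using assms(4-6) by (intro continuous_open_imp_quotient_map) (auto simp: top)
  have qp: "continuous_map T Z (q \<circ> p)"
    by (rule continuous_map_compose[OF pc quotient_imp_continuous_map[OF quot]])
  have "(q \<circ> p) a = (q \<circ> p) b" if "a \<in> topspace T" "b \<in> topspace T" "\<pi> a = \<pi> b" for a b
    using q_resp[of a b] that by (simp add: top)
  then obtain r where r: "continuous_map S Z r" "r ` topspace S = (q \<circ> p) ` topspace T"
      "\<And>x. x \<in> topspace T \<Longrightarrow> r (\<pi> x) = (q \<circ> p) x"
    by (rule quotient_map_lift_exists[OF \<pi>_quot qp]) iprover+
  have "g x = g y" if "x \<in> topspace R" "y \<in> topspace R" "q x = q y" for x y
    using g_resp[of x y] that by (simp add: topR)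
  then obtain k where k: "continuous_map Z M k" "k ` topspace Z = g ` topspace R"
      "\<And>x. x \<in> topspace R \<Longrightarrow> k (q x) = g x"
    by (rule quotient_map_lift_exists[OF quot g]) iprover+
  have r\<pi>: "r (\<pi> x) = q (p x)" if "x \<in> carrier G" for x using r(3) that by (simp add: top)
  have r_onto: "r ` carrier H = topspace Z"
    using r(2) unfolding top image_comp[symmetric] p_onto q_onto .
  have r_closed: "closed_map S Z r"
    unfolding closed_map_def
  proof (intro allI impI)
    fix C assume C: "closedin S C"
    have CH: "C \<subseteq> carrier H" using closedin_subset[OF C] top(2) by simp
    have "closedin R (p ` {x \<in> topspace T. \<pi> x \<in> C})"
      using p_closed closedin_continuous_map_preimage[OF assms(4) C] by (simp add: closed_map_def)
    \<comment> \<open>Closedness of the image of \<open>C\<close> is tested on its preimage in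
      \<open>R\<close>. The inclusion from right to left is the one that needs
      \<open>lift\<close>.\<close>
    moreover have "p ` {x \<in> topspace T. \<pi> x \<in> C} = {y \<in> topspace R. q y \<in> r ` C}"
    proof
      show "p ` {x \<in> topspace T. \<pi> x \<in> C} \<subseteq> {y \<in> topspace R. q y \<in> r ` C}"
        using r\<pi> by (force simp: top topR)
      show "{y \<in> topspace R. q y \<in> r ` C} \<subseteq> p ` {x \<in> topspace T. \<pi> x \<in> C}"
      proof clarify
        fix y c assume y: "y \<in> topspace R" and c: "c \<in> C" and eq: "q y = r c"
        obtain a b where ab: "a \<in> carrier G" "y = p a" "b \<in> carrier G" "c = \<pi> b"
          using y c CH unfolding topR p_onto[symmetric] assms(6)[symmetric] by blast
        then obtain x where "x \<in> carrier G" "p x = p a" "\<pi> x = \<pi> b"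
          using lift[of a b] eq r\<pi> by auto
        then show "y \<in> p ` {x \<in> topspace T. \<pi> x \<in> C}"
          using ab c by (intro image_eqI[of _ _ x]) (simp_all add: top)
      qed
    qed
    ultimately have "closedin R {y \<in> topspace R. q y \<in> r ` C}" by simp
    moreover have "r ` C \<subseteq> topspace Z" using CH r_onto by blast
    ultimately show "closedin Z (r ` C)" using quot unfolding quotient_map_closedin by meson
  qed
  have r_fib: "compactin S {y \<in> topspace S. r y = z}" if z: "z \<in> topspace Z" for z
  proof -
    obtain a where a: "a \<in> carrier G" "z = q (p a)"
      using z unfolding q_onto[symmetric] p_onto[symmetric] by blast
    \<comment> \<open>One representative \<open>a\<close> suffices: \<open>lift\<close> moves any
      \<open>b\<close> with \<open>\<pi> b\<close> in the fiber of \<open>r\<close> to an element of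
      the compact \<open>p\<close>-fiber through \<open>a\<close>, without changing
      \<open>\<pi> b\<close>.\<close>
    have "{y \<in> topspace S. r y = z} = \<pi> ` {x \<in> carrier G. p x = p a}"
    proof
      show "{y \<in> topspace S. r y = z} \<subseteq> \<pi> ` {x \<in> carrier G. p x = p a}"
      proof clarify
        fix y assume "y \<in> topspace S" "z = r y"
        then obtain b where b: "b \<in> carrier G" "y = \<pi> b" "q (p a) = q (p b)"
          using r\<pi> a unfolding top assms(6)[symmetric] by auto
        then obtain x where "x \<in> carrier G" "p x = p a" "\<pi> x = \<pi> b"
          using lift[of a b] a by blast
        then show "y \<in> \<pi> ` {x \<in> carrier G. p x = p a}"
          using b(2) by (intro image_eqI[of _ _ x]) simp_all
      qed
      show "\<pi> ` {x \<in> carrier G. p x = p a} \<subseteq> {y \<in> topspace S. r y = z}"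
        using r\<pi> a by (auto simp: top)
    qed
    then show ?thesis using image_compactin[OF p_fib assms(4), of "p a"] a by simp
  qed
  have "r \<in> hom H (K Mod p ` N)"
  proof (rule homI)
    show "r x \<in> carrier (K Mod p ` N)" if "x \<in> carrier H" for x
      using that r_onto topZ by blast
    fix x y assume "x \<in> carrier H" "y \<in> carrier H"
    then obtain a b where ab: "a \<in> carrier G" "x = \<pi> a" "b \<in> carrier G" "y = \<pi> b"
      unfolding assms(6)[symmetric] by blast
    then have "r (x \<otimes>\<^bsub>H\<^esub> y) = q (p (a \<otimes>\<^bsub>G\<^esub> b))" using r\<pi>[of "a \<otimes>\<^bsub>G\<^esub> b"] by simp
    also have "\<dots> = r x \<otimes>\<^bsub>K Mod p ` N\<^esub> r y"
      using ab r\<pi> hom_mult[OF q_hom, of "p a" "p b"] by simp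
    finally show "r (x \<otimes>\<^bsub>H\<^esub> y) = r x \<otimes>\<^bsub>K Mod p ` N\<^esub> r y" .
  qed
  then have "perfect_homomorphism H S (K Mod p ` N) Z r"
    using r(1) r_closed r_fib r_onto
    by (auto simp: perfect_homomorphism_def perfect_map_def proper_map_def top)
  moreover have "f x = k (r x)" if x: "x \<in> carrier H" for x
  proof -
    obtain a where a: "a \<in> carrier G" "x = \<pi> a" using x unfolding assms(6)[symmetric] by blast
    then have "f x = g (p a)" using bspec[OF fg, of a] by simp
    also have "\<dots> = k (r x)" using k(3)[of "p a"] a r\<pi> by (simp add: topR)
    finally show ?thesis .
  qed
  ultimately show "\<exists>(K :: 'a set set monoid) S' p g.
           topological_group K S' \<and> metrizable_space S' \<and> perfect_homomorphism H S K S' p \<and>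
           continuous_map S' M g \<and> (\<forall>x\<in>carrier H. f x = g (p x))"
    using Z k(1) by blast
qed

end
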